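(* Let $(a,b),(c,d)\in Z(\mathbb{S})$ be such that $(a,b)(c,d)=0$ and $n(a)=n(b)=n(c)=n(d)=1$. Define the following elements of $\mathbb{S}$: \begin{align*} f_0&=(1,0), & f_4&=(ac,-ad), & \tilde f_0&=(0,1), & \tilde f_4&=(ad,ac),\\ f_1&=(a,b), & f_5&=(c,d), & \tilde f_1&=(-b,a), & \tilde f_5&=(-d,c),\\ f_2&=(c,-d), & f_6&=(a,-b), & \tilde f_2&=(d,c), & \tilde f_6&=(b,a),\\ f_3&=(ac,ad), & f_7&=(0,ab), & \tilde f_3&=(-ad,ac), & \tilde f_7&=(-ab,0). \end{align*} Then $F=\{f_m,\tilde f_m \mid m=0,\dots,7\}$ is a basis of $\mathbb{S}$ which is orthogonal with respect to the inner product $\langle\cdot,\cdot\rangle$, and its multiplication table is the following (the entry in row $u$ and column $v$ is the product $uv$): $$ \begin{array}{|c||cccccccc|cccccccc|} \hline \times & f_0 & f_1 & f_2 & f_3 & f_4 & f_5 & f_6 & f_7 & \tilde f_0 & \tilde f_1 & \tilde f_2 & \tilde f_3 & \tilde f_4 & \tilde f_5 & \tilde f_6 & \tilde f_7\\ \hline f_0 & f_0 & f_1 & f_2 & f_3 & f_4 & f_5 & f_6 & f_7 & \tilde f_0 & \tilde f_1 & \tilde f_2 & \tilde f_3 & \tilde f_4 & \tilde f_5 & \tilde f_6 & \tilde f_7\\ f_1 & f_1 & -2f_0 & 2f_3 & -2f_2 & 0 & 0 & 2f_7 & -f_6 & \tilde f_1 & -2\tilde f_0 & -2\tilde f_3 &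 2\tilde f_2 & 0 & 0 & -2\tilde f_7 & \tilde f_6\\ f_2 & f_2 & -2f_3 & -2f_0 & 2f_1 & 0 & 2f_7 & 0 & -f_5 & \tilde f_2 & 2\tilde f_3 & -2\tilde f_0 & -2\tilde f_1 & 0 & -2\tilde f_7 & 0 & \tilde f_5\\ f_3 & f_3 & 2f_2 & -2f_1 & -2f_0 & 2f_7 & 0 & 0 & -f_4 & \tilde f_3 & -2\tilde f_2 & 2\tilde f_1 & -2\tilde f_0 & -2\tilde f_7 & 0 & 0 & \tilde f_4\\ f_4 & f_4 & 0 & 0 & -2f_7 & -2f_0 & -2f_6 & 2f_5 & f_3 & \tilde f_4 & 0 & 0 & 2\tilde f_7 & -2\tilde f_0 & 2\tilde f_6 & -2\tilde f_5 & -\tilde f_3\\ f_5 & f_5 & 0 & -2f_7 & 0 & 2f_6 & -2f_0 & -2f_4 & f_2 & \tilde f_5 & 0 & 2\tilde f_7 & 0 & -2\tilde f_6 & -2\tilde f_0 & 2\tilde f_4 & -\tilde f_2\\ f_6 & f_6 & -2f_7 & 0 & 0 & -2f_5 & 2f_4 & -2f_0 & f_1 & \tilde f_6 & 2\tilde f_7 & 0 & 0 & 2\tilde f_5 & -2\tilde f_4 & -2\tilde f_0 & -\tilde f_1\\ f_7 & f_7 & f_6 & f_5 & f_4 & -f_3 & -f_2 & -f_1 & -f_0 & \tilde f_7 & -\tilde f_6 & -\tilde f_5 & -\tilde f_4 & \tilde f_3 & \tilde f_2 & \tilde f_1 & -\tilde f_0\\ \hline \tilde f_0 & \tilde f_0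 & -\tilde f_1 & -\tilde f_2 & -\tilde f_3 & -\tilde f_4 & -\tilde f_5 & -\tilde f_6 & -\tilde f_7 & -f_0 & f_1 & f_2 & f_3 & f_4 & f_5 & f_6 & f_7\\ \tilde f_1 & \tilde f_1 & 2\tilde f_0 & -2\tilde f_3 & 2\tilde f_2 & 0 & 0 & -2\tilde f_7 & \tilde f_6 & -f_1 & -2f_0 & -2f_3 & 2f_2 & 0 & 0 & -2f_7 & f_6\\ \tilde f_2 & \tilde f_2 & 2\tilde f_3 & 2\tilde f_0 & -2\tilde f_1 & 0 & -2\tilde f_7 & 0 & \tilde f_5 & -f_2 & 2f_3 & -2f_0 & -2f_1 & 0 & -2f_7 & 0 & f_5\\ \tilde f_3 & \tilde f_3 & -2\tilde f_2 & 2\tilde f_1 & 2\tilde f_0 & -2\tilde f_7 & 0 & 0 & \tilde f_4 & -f_3 & -2f_2 & 2f_1 & -2f_0 & -2f_7 & 0 & 0 & f_4\\ \tilde f_4 & \tilde f_4 & 0 & 0 & 2\tilde f_7 & 2\tilde f_0 & 2\tilde f_6 & -2\tilde f_5 & -\tilde f_3 & -f_4 & 0 & 0 & 2f_7 & -2f_0 & 2f_6 & -2f_5 & -f_3\\ \tilde f_5 & \tilde f_5 & 0 & 2\tilde f_7 & 0 & -2\tilde f_6 & 2\tilde f_0 & 2\tilde f_4 & -\tilde f_2 & -f_5 & 0 & 2f_7 & 0 & -2f_6 & -2f_0 & 2f_4 & -f_2\\ \tilde f_6 & \tilde f_6 & 2\tilde f_7 & 0 & 0 & 2\tilde f_5 &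 -2\tilde f_4 & 2\tilde f_0 & -\tilde f_1 & -f_6 & 2f_7 & 0 & 0 & 2f_5 & -2f_4 & -2f_0 & -f_1\\ \tilde f_7 & \tilde f_7 & -\tilde f_6 & -\tilde f_5 & -\tilde f_4 & \tilde f_3 & \tilde f_2 & \tilde f_1 & \tilde f_0 & -f_7 & -f_6 & -f_5 & -f_4 & f_3 & f_2 & f_1 & -f_0\\ \hline \end{array} $$
   Context: Cayley-Dickson conventions. Let $\mathcal{M}_0=\mathbb{R}$ with trivial involution, and let $\mathcal{M}_{n+1}=\mathcal{M}_n\times\mathcal{M}_n$ with componentwise real vector space structure, product $(a,b)(c,d)=(ac-\bar d b,\ da+b\bar c)$ and involution $\overline{(a,b)}=(\bar a,-b)$. The octonions are $\mathbb{O}=\mathcal{M}_3$ and the sedenions are $\mathbb{S}=\mathcal{M}_4$, so a sedenion is a pair of octonions. The unit of $\mathbb{O}$ is $1$, and $(1,0)$ is the unit of $\mathbb{S}$. For an element $x$ of $\mathbb{O}$ or $\mathbb{S}$, the norm is $n(x)=x\bar x=\bar x x\in\mathbb{R}$ (no square root), and $\langle\cdot,\cdot\rangle$ is the associated symmetric bilinear form, $2\langle x,y\rangle=x\bar y+y\bar x$, which is the standard Euclidean inner product. $Z(\mathbb{S})$ denotes the set of zero divisors, i.e. nonzero $u\in\mathbb{S}$ for which there is a nonzero $v\in\mathbb{S}$ with $uv=0$ or $vu=0$. *)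

theory Defs
  imports "HOL-Analysis.Analysis"
begin

text \<open>
  The carrier of a doubled algebra is the library's product type, which already has the
  componentwise real vector space structure and the standard Euclidean inner product. Only
  multiplication, involution and unit are recorded here: the doubling formula needs both factors
  of the product to have the same type, so it cannot be an instance of the class \<^class>\<open>times\<close>.
\<close>

record 'a cd_algebra =
  cd_mult :: "'a \<Rightarrow> 'a \<Rightarrow> 'a"
  cd_conj :: "'a \<Rightarrow> 'a"
  cd_unit :: 'a

definition cd_real :: "real cd_algebra" where
  "cd_real = \<lparr>cd_mult = (*), cd_conj = (\<lambda>x. x), cd_unit = 1\<rparr>"

definition cd_double :: "'a::real_vector cd_algebra \<Rightarrow> ('a \<times> 'a) cd_algebra" where
  "cd_double A =
    \<lparr>cd_mult = (\<lambda>(a, b) (c, d).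
        (cd_mult A a c - cd_mult A (cd_conj A d) b, cd_mult A d a + cd_mult A b (cd_conj A c))),
     cd_conj = (\<lambda>(a, b). (cd_conj A a, - b)),
     cd_unit = (cd_unit A, 0)\<rparr>"

type_synonym octonion = "((real \<times> real) \<times> (real \<times> real)) \<times> ((real \<times> real) \<times> (real \<times> real))"
type_synonym sedenion = "octonion \<times> octonion"

definition Oct :: "octonion cd_algebra" where
  "Oct = cd_double (cd_double (cd_double cd_real))"

definition Sed :: "sedenion cd_algebra" where
  "Sed = cd_double Oct"

abbreviation oct_mult :: "octonion \<Rightarrow> octonion \<Rightarrow> octonion" (infixl "\<odot>" 70) where
  "x \<odot> y \<equiv> cd_mult Oct x y"

abbreviation sed_mult :: "sedenion \<Rightarrow> sedenion \<Rightarrow> sedenion" (infixl "\<otimes>" 70) where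
  "x \<otimes> y \<equiv> cd_mult Sed x y"

text \<open>
  A real number \<open>r\<close> is identified with \<open>r\<close> times the unit. The norm is the quadratic one, without
  square root. That the descriptions are well defined in the algebras above is shown below
  (\<open>Oct_norm\<close>, \<open>Sed_norm\<close>, \<open>Oct_inner\<close>, \<open>Sed_inner\<close>).
\<close>

definition cd_norm :: "'a::real_vector cd_algebra \<Rightarrow> 'a \<Rightarrow> real" where
  "cd_norm A x = (THE r. cd_mult A x (cd_conj A x) = r *\<^sub>R cd_unit A)"

definition cd_inner :: "'a::real_vector cd_algebra \<Rightarrow> 'a \<Rightarrow> 'a \<Rightarrow> real" where
  "cd_inner A x y =
    (THE r. cd_mult A x (cd_conj A y) + cd_mult A y (cd_conj A x) = (2 * r) *\<^sub>R cd_unit A)"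

definition zero_divisors :: "'a::zero cd_algebra \<Rightarrow> 'a set" where
  "zero_divisors A = {u. u \<noteq> 0 \<and> (\<exists>v. v \<noteq> 0 \<and> (cd_mult A u v = 0 \<or> cd_mult A v u = 0))}"

locale cd_normed =
  fixes A :: "'a::real_inner cd_algebra"
  assumes bilinear_mult: "bilinear (cd_mult A)"
    and linear_conj: "linear (cd_conj A)"
    and conj_conj: "cd_conj A (cd_conj A x) = x"
    and mult_conj: "cd_mult A x (cd_conj A x) = (x \<bullet> x) *\<^sub>R cd_unit A"
    and conj_mult: "cd_mult A (cd_conj A x) x = (x \<bullet> x) *\<^sub>R cd_unit A"
    and unit_nonzero: "cd_unit A \<noteq> 0"
begin

lemma norm_eq: "cd_norm A x = x \<bullet> x"
  unfolding cd_norm_def using unit_nonzero by (simp add: mult_conj)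

lemma mult_conj_add: "cd_mult A x (cd_conj A y) + cd_mult A y (cd_conj A x) = (2 * (x \<bullet> y)) *\<^sub>R cd_unit A"
proof -
  have "cd_mult A (x + y) (cd_conj A (x + y)) = ((x + y) \<bullet> (x + y)) *\<^sub>R cd_unit A"
    by (rule mult_conj)
  then show ?thesis
    by (simp add: linear_add[OF linear_conj] bilinear_ladd[OF bilinear_mult]
        bilinear_radd[OF bilinear_mult] mult_conj inner_commute algebra_simps scaleR_2 flip: scaleR_scaleR)
qed

lemma inner_eq: "cd_inner A x y = x \<bullet> y"
  unfolding cd_inner_def using unit_nonzero by (simp add: mult_conj_add)

lemma cd_normed_double: "cd_normed (cd_double A)"
proof (rule cd_normed.intro)
  note [simp] = bilinear_ladd[OF bilinear_mult] bilinear_radd[OF bilinear_mult]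
    bilinear_lmul[OF bilinear_mult] bilinear_rmul[OF bilinear_mult]
    bilinear_lneg[OF bilinear_mult] bilinear_rneg[OF bilinear_mult]
    linear_add[OF linear_conj] linear_scale[OF linear_conj] linear_neg[OF linear_conj]
    conj_conj mult_conj conj_mult
  show "bilinear (cd_mult (cd_double A))"
    by (auto simp: bilinear_def cd_double_def algebra_simps intro!: linearI)
  show "linear (cd_conj (cd_double A))"
    by (auto simp: cd_double_def intro!: linearI)
  show "cd_conj (cd_double A) (cd_conj (cd_double A) x) = x" for x
    by (auto simp: cd_double_def split: prod.splits)
  show "cd_mult (cd_double A) x (cd_conj (cd_double A) x) = (x \<bullet> x) *\<^sub>R cd_unit (cd_double A)" for x
    by (cases x) (simp add: cd_double_def algebra_simps)
  show "cd_mult (cd_double A) (cd_conj (cd_double A) x) x = (x \<bullet> x) *\<^sub>R cd_unit (cd_double A)" for x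
    by (cases x) (simp add: cd_double_def algebra_simps)
  show "cd_unit (cd_double A) \<noteq> 0"
    using unit_nonzero by (simp add: cd_double_def zero_prod_def)
qed

end

lemma cd_normed_real: "cd_normed cd_real"
  by unfold_locales
    (auto simp: cd_real_def bilinear_def algebra_simps intro!: linearI)

lemma cd_normed_Oct: "cd_normed Oct"
  unfolding Oct_def by (intro cd_normed.cd_normed_double cd_normed_real)

lemma cd_normed_Sed: "cd_normed Sed"
  unfolding Sed_def by (intro cd_normed.cd_normed_double cd_normed_Oct)

lemma Oct_norm:
  "x \<odot> cd_conj Oct x = cd_norm Oct x *\<^sub>R cd_unit Oct"
  "cd_conj Oct x \<odot> x = cd_norm Oct x *\<^sub>R cd_unit Oct"
  using cd_normed_Oct by (simp_all add: cd_normed.norm_eq cd_normed.mult_conj cd_normed.conj_mult)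

lemma Sed_norm:
  "x \<otimes> cd_conj Sed x = cd_norm Sed x *\<^sub>R cd_unit Sed"
  "cd_conj Sed x \<otimes> x = cd_norm Sed x *\<^sub>R cd_unit Sed"
  using cd_normed_Sed by (simp_all add: cd_normed.norm_eq cd_normed.mult_conj cd_normed.conj_mult)

lemma Oct_inner: "cd_inner Oct x y = x \<bullet> y"
  using cd_normed_Oct by (rule cd_normed.inner_eq)

lemma Sed_inner: "cd_inner Sed x y = x \<bullet> y"
  using cd_normed_Sed by (rule cd_normed.inner_eq)

end

theory Submission
  imports Defs
begin

text \<open>
  Write \<open>x\<^sup>*\<close> for the conjugate of \<open>x\<close>. Eight octonions carry the whole statement:
  \<open>1, a, b, c, d, ab, ac, ad\<close>. Once these are known to be orthonormal, and the last seven to form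
  seven lines \<open>(u, v, w)\<close> on which \<open>uv = w\<close>, \<open>vw = u\<close>, \<open>wu = v\<close> and
  each reversed product changes sign, orthogonality of \<open>F\<close> and each of the 256 products are finite
  computations. Sixteen nonzero orthogonal vectors in a space of dimension 16 form a basis.

  So the point is to extract the seven lines from \<open>(a, b)(c, d) = 0\<close>, that is, from
  \<open>ac = d\<^sup>* b\<close> and \<open>da = - b c\<^sup>*\<close>. Solving both equations for \<open>d\<close> gives
  \<open>b (c\<^sup>* a\<^sup>*) = d = - (b c\<^sup>*) a\<^sup>*\<close>: the three unit octonions
  \<open>b, c\<^sup>*, a\<^sup>*\<close> associate as badly as possible, their associator being
  \<open>-2d\<close>, of length 2. An associator sees only the imaginary parts of its arguments, so its
  length is at most twice the product of the lengths of these parts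
  (\<open>norm_associator_le\<close>); hence \<open>a, b, c\<close> are purely imaginary
  (\<open>imaginary_if_associator_maximal\<close>). An associator is also orthogonal to \<open>1\<close> and to
  its arguments (\<open>associator_orthogonal\<close>), which makes \<open>d\<close> imaginary and orthogonal to
  \<open>a, b, c\<close>; the pairwise orthogonality of \<open>a, b, c\<close> follows by putting the
  formulas for \<open>d\<close> into \<open>d \<bottom> b\<close>, \<open>d \<bottom> a\<close> and
  \<open>d \<bottom> c\<close>. Two orthogonal imaginary units and their product form a line
  (\<open>quaternionic_triple_mult\<close>), and the seven lines are found one by one
  (\<open>zero_product_quaternionic_triples\<close>).

  Two octonion laws are behind these steps. Multiplication by \<open>x\<^sup>*\<close> is the adjoint of
  multiplication by \<open>x\<close>, which is inherited by every double; and
  \<open>x\<^sup>* (x y) = n(x) y\<close>, which holds in the double of an associative algebra, here of the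
  quaternions.
\<close>

section \<open>Adjoint multiplication and alternativity under doubling\<close>

text \<open>
  These laws hold in every iterated double of the reals. The reflection formula for the
  involution is what lets the real part be read off as an inner product with the unit, and the
  adjoint laws replace associativity in inner products.
\<close>

locale cd_star = cd_normed +
  assumes unit_left: "cd_mult A (cd_unit A) x = x"
    and unit_right: "cd_mult A x (cd_unit A) = x"
    and unit_inner: "cd_unit A \<bullet> cd_unit A = 1"
    and conj_reflection: "cd_conj A x = (2 * (x \<bullet> cd_unit A)) *\<^sub>R cd_unit A - x"
    and conj_of_mult: "cd_conj A (cd_mult A x y) = cd_mult A (cd_conj A y) (cd_conj A x)"
    and adjoint_left: "cd_mult A x y \<bullet> z = y \<bullet> cd_mult A (cd_conj A x) z"
    and adjoint_right: "cd_mult A x y \<bullet> z = x \<bullet> cd_mult A z (cd_conj A y)"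
begin

lemmas mult_simps =
  bilinear_ladd[OF bilinear_mult] bilinear_radd[OF bilinear_mult]
  bilinear_lsub[OF bilinear_mult] bilinear_rsub[OF bilinear_mult]
  bilinear_lmul[OF bilinear_mult] bilinear_rmul[OF bilinear_mult]
  bilinear_lneg[OF bilinear_mult] bilinear_rneg[OF bilinear_mult]
  bilinear_lzero[OF bilinear_mult] bilinear_rzero[OF bilinear_mult]

lemmas conj_simps =
  linear_add[OF linear_conj] linear_diff[OF linear_conj] linear_neg[OF linear_conj]
  linear_0[OF linear_conj] conj_conj conj_of_mult

lemma conj_unit: "cd_conj A (cd_unit A) = cd_unit A"
  by (simp add: conj_reflection unit_inner scaleR_2)

lemma cd_star_double: "cd_star (cd_double A)"
proof (intro cd_star.intro cd_star_axioms.intro cd_normed_double)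
  fix x y z :: "'a \<times> 'a"
  obtain a b c d e f where [simp]: "x = (a, b)" "y = (c, d)" "z = (e, f)"
    by (metis surj_pair)
  show "cd_mult (cd_double A) (cd_unit (cd_double A)) x = x"
    "cd_mult (cd_double A) x (cd_unit (cd_double A)) = x"
    "cd_unit (cd_double A) \<bullet> cd_unit (cd_double A) = 1"
    by (simp_all add: cd_double_def mult_simps conj_simps unit_left unit_right conj_unit unit_inner)
  show "cd_conj (cd_double A) x = (2 * (x \<bullet> cd_unit (cd_double A))) *\<^sub>R cd_unit (cd_double A) - x"
    by (simp add: cd_double_def conj_reflection)
  show "cd_conj (cd_double A) (cd_mult (cd_double A) x y) =
      cd_mult (cd_double A) (cd_conj (cd_double A) y) (cd_conj (cd_double A) x)"
    by (simp add: cd_double_def mult_simps conj_simps)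
  \<comment> \<open>In these two terms of the product the component of \<open>y\<close> is conjugated; one adjoint law
    isolates \<open>b\<close>, and the other then frees that component.\<close>
  have sw: "cd_mult A (cd_conj A d) b \<bullet> e = d \<bullet> cd_mult A b (cd_conj A e)"
    "cd_mult A b (cd_conj A c) \<bullet> f = c \<bullet> cd_mult A (cd_conj A f) b"
    using adjoint_left[of "cd_conj A d" b e] adjoint_right[of d e b]
      adjoint_right[of b "cd_conj A c" f] adjoint_left[of f c b]
    by (simp_all add: conj_conj inner_commute)
  show "cd_mult (cd_double A) x y \<bullet> z = y \<bullet> cd_mult (cd_double A) (cd_conj (cd_double A) x) z"
    using adjoint_left[of a c e] adjoint_right[of d a f]
    by (simp add: cd_double_def mult_simps conj_simps inner_diff_left inner_diff_right
        inner_add_left inner_add_right sw)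
  have sw: "cd_mult A (cd_conj A d) b \<bullet> e = b \<bullet> cd_mult A d e"
    "cd_mult A d a \<bullet> f = a \<bullet> cd_mult A (cd_conj A d) f"
    "cd_mult A b (cd_conj A c) \<bullet> f = b \<bullet> cd_mult A f c"
    "cd_mult A a c \<bullet> e = a \<bullet> cd_mult A e (cd_conj A c)"
    by (simp_all add: adjoint_left[of "cd_conj A d"] adjoint_left[of d] adjoint_right[of b]
        adjoint_right[of a] conj_conj)
  show "cd_mult (cd_double A) x y \<bullet> z = x \<bullet> cd_mult (cd_double A) z (cd_conj (cd_double A) y)"
    by (simp add: cd_double_def mult_simps conj_simps inner_diff_left inner_diff_right
        inner_add_left inner_add_right sw)
qed

text \<open>
  In the components of the double, with \<open>x = (a, b)\<close>, associativity of \<open>A\<close> brings the two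
  factors \<open>a\<close>, or the two factors \<open>b\<close>, of a term together, where they give \<open>n(a)\<close> or
  \<open>n(b)\<close>; the terms with one factor of each cancel.
\<close>

lemma alternative_double:
  assumes assoc: "\<And>x y z. cd_mult A (cd_mult A x y) z = cd_mult A x (cd_mult A y z)"
  shows "cd_mult (cd_double A) (cd_conj (cd_double A) x) (cd_mult (cd_double A) x y) = (x \<bullet> x) *\<^sub>R y"
    and "cd_mult (cd_double A) (cd_mult (cd_double A) y x) (cd_conj (cd_double A) x) = (x \<bullet> x) *\<^sub>R y"
proof -
  have [simp]: "cd_mult A (cd_conj A x) (cd_mult A x y) = (x \<bullet> x) *\<^sub>R y"
    "cd_mult A x (cd_mult A (cd_conj A x) y) = (x \<bullet> x) *\<^sub>R y" for x y
    by (simp_all add: mult_conj conj_mult mult_simps unit_left flip: assoc)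
  obtain a b c d where "x = (a, b)" "y = (c, d)"
    by (metis surj_pair)
  then show "cd_mult (cd_double A) (cd_conj (cd_double A) x) (cd_mult (cd_double A) x y) = (x \<bullet> x) *\<^sub>R y"
    "cd_mult (cd_double A) (cd_mult (cd_double A) y x) (cd_conj (cd_double A) x) = (x \<bullet> x) *\<^sub>R y"
    by (simp_all add: cd_double_def mult_simps conj_simps assoc mult_conj conj_mult unit_right scaleR_add_left)
qed

text \<open>
  Each doubling costs one property: the trivial involution of the reals makes the complex numbers
  commutative, and these make the quaternions associative.
\<close>

lemma assoc_double:
  assumes "\<And>x y z. cd_mult A (cd_mult A x y) z = cd_mult A x (cd_mult A y z)"
    and comm: "\<And>x y. cd_mult A x y = cd_mult A y x"
  shows "cd_mult (cd_double A) (cd_mult (cd_double A) x y) z =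
      cd_mult (cd_double A) x (cd_mult (cd_double A) y z)"
proof -
  \<comment> \<open>Left-commutativity completes the rules to an ordered rewrite system that sorts all products.\<close>
  have "cd_mult A x (cd_mult A y z) = cd_mult A y (cd_mult A x z)" for x y z
    by (metis assms)
  then show ?thesis
    by (cases x; cases y; cases z)
      (simp add: cd_double_def mult_simps conj_simps assms(1) comm algebra_simps)
qed

lemma comm_double:
  assumes "\<And>x y. cd_mult A x y = cd_mult A y x" and "\<And>x. cd_conj A x = x"
  shows "cd_mult (cd_double A) x y = cd_mult (cd_double A) y x"
  by (cases x; cases y) (simp add: cd_double_def assms(2), metis assms(1) add.commute)

end

lemma cd_star_real: "cd_star cd_real"
  using cd_normed_real
  by (simp add: cd_star_def cd_star_axioms_def) (simp add: cd_real_def)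

lemma cd_star_Oct: "cd_star Oct"
  unfolding Oct_def by (intro cd_star.cd_star_double cd_star_real)

interpretation oct: cd_star Oct
  by (rule cd_star_Oct)

lemma oct_alternative:
  "cd_conj Oct x \<odot> (x \<odot> y) = (x \<bullet> x) *\<^sub>R y"
  "(y \<odot> x) \<odot> cd_conj Oct x = (x \<bullet> x) *\<^sub>R y"
proof -
  interpret R: cd_star cd_real by (rule cd_star_real)
  interpret C: cd_star "cd_double cd_real" by (rule R.cd_star_double)
  interpret H: cd_star "cd_double (cd_double cd_real)" by (rule C.cd_star_double)
  have C_comm: "cd_mult (cd_double cd_real) x y = cd_mult (cd_double cd_real) y x" for x y
    by (rule R.comm_double) (simp_all add: cd_real_def)
  have C_assoc: "cd_mult (cd_double cd_real) (cd_mult (cd_double cd_real) x y) z =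
      cd_mult (cd_double cd_real) x (cd_mult (cd_double cd_real) y z)" for x y z
    by (rule R.assoc_double) (simp_all add: cd_real_def)
  show
    "cd_conj Oct x \<odot> (x \<odot> y) = (x \<bullet> x) *\<^sub>R y"
    "(y \<odot> x) \<odot> cd_conj Oct x = (x \<bullet> x) *\<^sub>R y"
    unfolding Oct_def by (intro H.alternative_double C.assoc_double C_comm C_assoc)+
qed

section \<open>Octonion norm and associator\<close>

lemmas oct_inner_adjoint = oct.adjoint_left oct.adjoint_right
lemmas oct_conj_eq = oct.conj_reflection
lemmas [simp] = oct.mult_simps oct.unit_left oct.unit_right oct.unit_inner

text \<open>
  Moving one factor across with the adjoint law leaves \<open>x\<^sup>* (x z) = n(x) z\<close>: up to scale,
  multiplication by a fixed octonion is an isometry.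
\<close>

lemma oct_inner_mult_same:
  "(x \<odot> y) \<bullet> (x \<odot> z) = (x \<bullet> x) * (y \<bullet> z)"
  "(y \<odot> x) \<bullet> (z \<odot> x) = (x \<bullet> x) * (y \<bullet> z)"
  by (simp_all add: oct_inner_adjoint(1)[of x y] oct_inner_adjoint(2)[of y x] oct_alternative)

lemma oct_norm_mult: "norm (x \<odot> y) = norm x * norm y"
  by (simp add: norm_eq_sqrt_inner oct_inner_mult_same real_sqrt_mult)

definition associator :: "octonion \<Rightarrow> octonion \<Rightarrow> octonion \<Rightarrow> octonion" where
  "associator x y z = (x \<odot> y) \<odot> z - x \<odot> (y \<odot> z)"

text \<open>
  Each of the two bracketings has the same inner product with \<open>1\<close> and with every argument;
  the adjoint laws bring both to a common form. For the middle argument \<open>y\<close> the common part is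
  the inner product of \<open>xy\<close> and \<open>yz\<close>, once the conjugates of \<open>x\<close> and \<open>z\<close>
  are expanded into real part and reflection.
\<close>

lemma associator_orthogonal:
  "associator x y z \<bullet> cd_unit Oct = 0"
  "associator x y z \<bullet> x = 0"
  "associator x y z \<bullet> y = 0"
  "associator x y z \<bullet> z = 0"
proof -
  let ?c = "cd_conj Oct"
  have self: "(u \<odot> v) \<bullet> u = (u \<bullet> u) * (v \<bullet> cd_unit Oct)"
    "(v \<odot> u) \<bullet> u = (u \<bullet> u) * (v \<bullet> cd_unit Oct)" for u v
    using oct_inner_mult_same(1)[of u v "cd_unit Oct"] oct_inner_mult_same(2)[of v u "cd_unit Oct"]
    by simp_all
  have tr: "(u \<odot> v) \<bullet> cd_unit Oct = u \<bullet> ?c v" "(u \<odot> v) \<bullet> cd_unit Oct = v \<bullet> ?c u" for u v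
    using oct_inner_adjoint[of u v "cd_unit Oct"] by simp_all
  show "associator x y z \<bullet> cd_unit Oct = 0"
    by (simp add: associator_def inner_diff_left tr(1)[of "x \<odot> y"] tr(2)[of x "y \<odot> z"]
        oct_inner_adjoint(1)[of x y] oct_inner_adjoint(2)[of y z])
  show "associator x y z \<bullet> x = 0"
    by (simp add: associator_def inner_diff_left self oct_inner_adjoint(2)[of "x \<odot> y"]
        oct_inner_mult_same tr(1))
  show "associator x y z \<bullet> z = 0"
    by (simp add: associator_def inner_diff_left self oct_inner_adjoint(1)[of x "y \<odot> z"]
        oct_inner_mult_same tr(2))
  have "associator x y z \<bullet> y = (x \<odot> y) \<bullet> (y \<odot> ?c z) - (y \<odot> z) \<bullet> (?c x \<odot> y)"
    by (simp add: associator_def inner_diff_left oct_inner_adjoint(2)[of "x \<odot> y"]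
        oct_inner_adjoint(1)[of x "y \<odot> z"])
  then show "associator x y z \<bullet> y = 0"
    by (simp add: oct_conj_eq self inner_diff_right inner_commute[of "x \<odot> y"])
qed

text \<open>
  The associator is trilinear and vanishes as soon as one argument is real, so it may be computed from
  the imaginary parts; there the triangle inequality and multiplicativity of the norm suffice.
\<close>

lemma norm_associator_le:
  fixes x y z :: octonion
  defines "im \<equiv> \<lambda>x. x - (x \<bullet> cd_unit Oct) *\<^sub>R cd_unit Oct"
  shows "norm (associator x y z) \<le> 2 * (norm (im x) * norm (im y) * norm (im z))"
proof -
  have "associator x y z = associator (im x) (im y) (im z)"
    by (simp add: associator_def im_def algebra_simps)
  also have "norm \<dots> \<le> norm ((im x \<odot> im y) \<odot> im z) + norm (im x \<odot> (im y \<odot> im z))"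
    unfolding associator_def by (rule norm_triangle_ineq4)
  finally show ?thesis by (simp add: oct_norm_mult)
qed

text \<open>
  The imaginary part of a unit octonion has length at most 1, with equality only when the real part
  vanishes, so the preceding bound can reach 2 only if all three arguments are imaginary.
\<close>

lemma imaginary_if_associator_maximal:
  fixes x y z :: octonion
  assumes "norm x = 1" "norm y = 1" "norm z = 1" "norm (associator x y z) = 2"
  shows "x \<bullet> cd_unit Oct = 0" "y \<bullet> cd_unit Oct = 0" "z \<bullet> cd_unit Oct = 0"
proof -
  define im where "im x = x - (x \<bullet> cd_unit Oct) *\<^sub>R cd_unit Oct" for x :: octonion
  have sq: "norm (im x) ^ 2 = 1 - (x \<bullet> cd_unit Oct) ^ 2" if "norm x = 1" for x
    using that
    by (simp add: im_def norm_eq_1 inner_diff_left inner_diff_right inner_commute power2_norm_eq_inner)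
       (simp add: power2_eq_square)
  have le: "norm (im x) \<le> 1" if "norm x = 1" for x
    by (rule power2_le_imp_le) (simp_all add: sq that)
  have "1 \<le> norm (im x) * norm (im y) * norm (im z)"
    using norm_associator_le[of x y z] assms(4) by (simp add: im_def)
  moreover have "norm (im x) * norm (im y) * norm (im z) \<le> norm (im w)" if "w \<in> {x, y, z}" for w
  proof -
    have "norm (im x) * norm (im y) \<le> norm (im x)" "norm (im x) * norm (im y) \<le> norm (im y)"
      "norm (im x) * norm (im y) \<le> 1"
      using assms by (simp_all add: le mult_left_le mult_left_le_one_le mult_le_one)
    moreover have "norm (im x) * norm (im y) * norm (im z) \<le> norm (im x) * norm (im y)"
      "norm (im x) * norm (im y) * norm (im z) \<le> norm (im z)"
      using assms calculation(3) by (simp_all add: le mult_left_le mult_left_le_one_le)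
    ultimately show ?thesis
      using that by force
  qed
  ultimately have "1 \<le> norm (im w)" if "w \<in> {x, y, z}" for w
    using that by (meson order_trans)
  then have "norm (im w) = 1" if "w \<in> {x, y, z}" for w
    using that le[of w] assms by (intro antisym) auto
  then have "w \<bullet> cd_unit Oct = 0" if "w \<in> {x, y, z}" for w
    using that sq[of w] assms by auto
  then show "x \<bullet> cd_unit Oct = 0" "y \<bullet> cd_unit Oct = 0" "z \<bullet> cd_unit Oct = 0"
    by simp_all
qed

section \<open>Quaternionic triples of imaginary units\<close>

definition imaginary_unit :: "octonion \<Rightarrow> bool" where
  "imaginary_unit u \<longleftrightarrow> u \<bullet> cd_unit Oct = 0 \<and> u \<bullet> u = 1"

lemma imaginary_unit_conj: "imaginary_unit u \<Longrightarrow> cd_conj Oct u = - u"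
  by (simp add: imaginary_unit_def oct_conj_eq)

lemma imaginary_unit_alternative:
  assumes "imaginary_unit u"
  shows "u \<odot> (u \<odot> y) = - y" "(y \<odot> u) \<odot> u = - y" "u \<odot> u = - cd_unit Oct"
proof -
  show *: "u \<odot> (u \<odot> y) = - y" "(y \<odot> u) \<odot> u = - y" for y
    using oct_alternative[where x = u and y=y] assms
    by (simp_all add: imaginary_unit_conj imaginary_unit_def minus_equation_iff[of _ y])
  show "u \<odot> u = - cd_unit Oct" using *[of "cd_unit Oct"] by simp
qed

text \<open>
  This is the polarization of \<open>u (u y) = - n(u) y\<close>, applied to the imaginary octonion
  \<open>u + v\<close>.
\<close>

lemma left_mult_anticommute:
  assumes "imaginary_unit u" "imaginary_unit v" "u \<bullet> v = 0"
  shows "u \<odot> (v \<odot> y) = - (v \<odot> (u \<odot> y))"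
proof -
  have "cd_conj Oct (u + v) = - (u + v)"
    using assms by (simp add: imaginary_unit_def oct_conj_eq inner_add_left)
  then have "- ((u + v) \<odot> ((u + v) \<odot> y)) = 2 *\<^sub>R y"
    using oct_alternative(1)[of "u + v" y] assms
    by (simp add: imaginary_unit_def inner_add_left inner_add_right inner_commute)
  then show ?thesis
    using assms(1,2) by (simp add: imaginary_unit_alternative algebra_simps scaleR_2 eq_neg_iff_add_eq_0)
qed

lemma imaginary_units_anticommute:
  assumes "imaginary_unit u" "imaginary_unit v" "u \<bullet> v = 0"
  shows "u \<odot> v = - (v \<odot> u)"
  using left_mult_anticommute[OF assms, of "cd_unit Oct"] by simp

text \<open>
  Such a triple multiplies like the quaternion units \<open>i, j, k\<close>, so together with the unit it
  spans a copy of the quaternions.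
\<close>

definition quaternionic_triple :: "octonion \<Rightarrow> octonion \<Rightarrow> octonion \<Rightarrow> bool" where
  "quaternionic_triple u v w \<longleftrightarrow>
     imaginary_unit u \<and> imaginary_unit v \<and> imaginary_unit w \<and>
     u \<bullet> v = 0 \<and> u \<bullet> w = 0 \<and> v \<bullet> w = 0 \<and>
     u \<odot> v = w \<and> v \<odot> w = u \<and> w \<odot> u = v \<and>
     v \<odot> u = - w \<and> w \<odot> v = - u \<and> u \<odot> w = - v"

lemma quaternionic_triple_mult:
  assumes "imaginary_unit u" "imaginary_unit v" "u \<bullet> v = 0"
  shows "quaternionic_triple u v (u \<odot> v)"
proof -
  note ac = imaginary_units_anticommute[OF assms]
  have "(u \<odot> v) \<bullet> cd_unit Oct = 0"
    using assms by (simp add: oct_inner_adjoint(1)[of u v] imaginary_unit_conj inner_commute[of v])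
  moreover have "(u \<odot> v) \<bullet> (u \<odot> v) = 1"
    using assms by (simp add: oct_inner_mult_same imaginary_unit_def)
  moreover have "u \<bullet> (u \<odot> v) = 0" "v \<bullet> (u \<odot> v) = 0"
    using oct_inner_mult_same(1)[of u "cd_unit Oct" v] oct_inner_mult_same(2)[of "cd_unit Oct" v u] assms
    by (simp_all add: imaginary_unit_def inner_commute)
  moreover have "v \<odot> (u \<odot> v) = u" "(u \<odot> v) \<odot> u = v"
    using assms by (simp_all add: ac imaginary_unit_alternative)
  ultimately show ?thesis
    using assms by (simp add: quaternionic_triple_def imaginary_unit_alternative, simp add: imaginary_unit_def ac)
qed

section \<open>The octonions in a vanishing sedenion product\<close>

lemma Sed_mult_Pair:
  "(a, b) \<otimes> (c, d) = (a \<odot> c - cd_conj Oct d \<odot> b, d \<odot> a + b \<odot> cd_conj Oct c)"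
  by (simp add: Sed_def cd_double_def)

lemma Pair_eq_zero: "(x, y) = 0 \<longleftrightarrow> x = 0 \<and> y = 0"
  by (simp add: zero_prod_def)

text \<open>
  The seven triples are the lines of the Fano plane on \<open>a, b, c, d, ab, ac, ad\<close>, each oriented so
  that no sign appears. Any two points lie on a line, so the triples determine every product of two
  distinct ones among these octonions and give their orthogonality.
\<close>

lemma zero_product_quaternionic_triples:
  assumes zero: "(a, b) \<otimes> (c, d) = 0"
    and unit: "a \<bullet> a = 1" "b \<bullet> b = 1" "c \<bullet> c = 1" "d \<bullet> d = 1"
  shows "quaternionic_triple a b (a \<odot> b)"
    and "quaternionic_triple a c (a \<odot> c)"
    and "quaternionic_triple a d (a \<odot> d)"
    and "quaternionic_triple c b (a \<odot> d)"
    and "quaternionic_triple b d (a \<odot> c)"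
    and "quaternionic_triple d c (a \<odot> b)"
    and "quaternionic_triple (a \<odot> b) (a \<odot> c) (a \<odot> d)"
proof -
  let ?c = "cd_conj Oct"
  have ac: "a \<odot> c = ?c d \<odot> b" and da: "d \<odot> a = - (b \<odot> ?c c)"
    using zero by (simp_all add: Sed_mult_Pair Pair_eq_zero eq_neg_iff_add_eq_0)
  have d1: "b \<odot> (?c c \<odot> ?c a) = d"
    using oct_alternative(1)[of "?c b" d] arg_cong[OF ac, of ?c] unit(2)
    by (simp add: oct.conj_simps) (simp add: oct_conj_eq inner_diff_left inner_diff_right inner_commute)
  have d2: "(b \<odot> ?c c) \<odot> ?c a = - d"
    using oct_alternative(2)[of d a] unit(1) by (simp add: da minus_equation_iff[of _ d])
  have assoc: "associator b (?c c) (?c a) = - (2 *\<^sub>R d)"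
    by (simp add: associator_def d1 d2 scaleR_2)
  have conj_inner: "?c x \<bullet> cd_unit Oct = x \<bullet> cd_unit Oct" "norm (?c x) = norm x" for x
    by (simp_all add: oct_conj_eq norm_eq_sqrt_inner inner_diff_left inner_diff_right inner_commute)
  have "b \<bullet> cd_unit Oct = 0" "?c c \<bullet> cd_unit Oct = 0" "?c a \<bullet> cd_unit Oct = 0"
    using imaginary_if_associator_maximal[of b "?c c" "?c a"] unit
    by (simp_all add: assoc conj_inner norm_eq_1)
  moreover have "d \<bullet> cd_unit Oct = 0"
    using associator_orthogonal(1)[of b "?c c" "?c a"] by (simp add: assoc)
  ultimately have im: "imaginary_unit a" "imaginary_unit b" "imaginary_unit c" "imaginary_unit d"
    using unit by (simp_all add: imaginary_unit_def conj_inner)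
  have perp_d: "a \<bullet> d = 0" "b \<bullet> d = 0" "c \<bullet> d = 0"
    using associator_orthogonal(2-4)[of b "?c c" "?c a", unfolded assoc]
    by (simp_all add: imaginary_unit_conj im inner_commute)
  note [simp] = imaginary_unit_conj[OF im(1)] imaginary_unit_conj[OF im(2)]
     imaginary_unit_conj[OF im(3)] imaginary_unit_conj[OF im(4)]
  have da': "d \<odot> a = b \<odot> c" and ac': "a \<odot> c = - (d \<odot> b)"
    using da ac by simp_all
  \<comment> \<open>Now \<open>b (c a) = d = - (b c) a\<close>, so \<open>d \<bottom> b\<close> says that \<open>c a\<close> has no real part, and
    \<open>d \<bottom> a\<close> that \<open>b c\<close> has none.\<close>
  have ca: "a \<bullet> c = 0"
    using perp_d(2) oct_inner_mult_same(1)[of b "cd_unit Oct" "c \<odot> a"]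
      oct_inner_adjoint(2)[of c a "cd_unit Oct"] d1 unit(2)
    by (simp add: inner_commute)
  have bc: "b \<bullet> c = 0"
    using perp_d(1) oct_inner_mult_same(2)[of "cd_unit Oct" a "b \<odot> c"]
      oct_inner_adjoint(2)[of b c "cd_unit Oct"] d2 unit(1)
    by (simp add: inner_commute)
  have "a \<bullet> b = (a \<odot> c) \<bullet> (b \<odot> c)"
    using unit(3) by (simp add: oct_inner_mult_same)
  also have "\<dots> = (b \<odot> (c \<odot> a)) \<bullet> c"
    using imaginary_units_anticommute[OF im(1,3) ca] by (simp add: oct_inner_adjoint(1)[of b])
  finally have ab: "a \<bullet> b = 0"
    using perp_d(3) d1 by (simp add: inner_commute)
  show ab_triple: "quaternionic_triple a b (a \<odot> b)"
    and ac_triple: "quaternionic_triple a c (a \<odot> c)"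
    and ad_triple: "quaternionic_triple a d (a \<odot> d)"
    by (intro quaternionic_triple_mult im ab ca perp_d)+
  have cb: "c \<bullet> b = 0" and dc: "d \<bullet> c = 0"
    using bc perp_d(3) by (simp_all add: inner_commute)
  have "c \<odot> b = a \<odot> d"
    using imaginary_units_anticommute[OF im(1,4) perp_d(1)] imaginary_units_anticommute[OF im(3,2) cb]
    by (simp add: da')
  then show "quaternionic_triple c b (a \<odot> d)"
    using quaternionic_triple_mult[OF im(3,2) cb] by simp
  have "b \<odot> d = a \<odot> c"
    using imaginary_units_anticommute[OF im(2,4) perp_d(2)] by (simp add: ac')
  then show "quaternionic_triple b d (a \<odot> c)"
    using quaternionic_triple_mult[OF im(2,4) perp_d(2)] by simp
  \<comment> \<open>The remaining products are moved into place by letting left multiplications by orthogonal imaginary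
    units anticommute, since they cannot be reassociated.\<close>
  have "d = a \<odot> (b \<odot> c)"
    using ad_triple by (simp add: quaternionic_triple_def flip: da')
  then have "c \<odot> d = c \<odot> (a \<odot> (b \<odot> c))"
    by simp
  also have "\<dots> = - (a \<odot> (c \<odot> (b \<odot> c)))"
    using left_mult_anticommute[OF im(3,1)] ca by (simp add: inner_commute)
  also have "c \<odot> (b \<odot> c) = b"
    using quaternionic_triple_mult[OF im(2,3) bc] by (simp add: quaternionic_triple_def)
  finally have "d \<odot> c = a \<odot> b"
    using imaginary_units_anticommute[OF im(4,3) dc] by simp
  with quaternionic_triple_mult[OF im(4,3) dc]
  show dc_triple: "quaternionic_triple d c (a \<odot> b)"
    by simp
  have "(a \<odot> b) \<odot> (a \<odot> c) = - (a \<odot> ((a \<odot> b) \<odot> c))"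
    using ab_triple by (intro left_mult_anticommute) (simp_all add: quaternionic_triple_def inner_commute)
  also have "(a \<odot> b) \<odot> c = - d"
    using dc_triple by (simp add: quaternionic_triple_def)
  finally have "(a \<odot> b) \<odot> (a \<odot> c) = a \<odot> d"
    by simp
  moreover have "(a \<odot> b) \<bullet> (a \<odot> c) = 0"
    using bc by (simp add: oct_inner_mult_same)
  ultimately show "quaternionic_triple (a \<odot> b) (a \<odot> c) (a \<odot> d)"
    using quaternionic_triple_mult[of "a \<odot> b" "a \<odot> c"] ab_triple ac_triple
    by (simp add: quaternionic_triple_def)
qed

section \<open>The orthogonal basis and its multiplication table\<close>

text \<open>
  Taking the basis as a list makes distinctness of its entries a consequence: a nonzero vector is not
  orthogonal to itself. The basis then has as many elements as the dimension.
\<close>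

lemma orthogonal_list_basis:
  fixes xs :: "'a::euclidean_space list"
  assumes orth: "sorted_wrt (\<lambda>u v. u \<bullet> v = 0) xs" and "0 \<notin> set xs" and "length xs = DIM('a)"
  shows "independent (set xs)" "span (set xs) = UNIV" "pairwise (\<lambda>u v. u \<bullet> v = 0) (set xs)"
proof -
  have "distinct xs"
    using assms(1,2) by (induction xs) auto
  show pw: "pairwise (\<lambda>u v. u \<bullet> v = 0) (set xs)"
    using orth by (induction xs) (auto simp: pairwise_insert inner_commute)
  then show ind: "independent (set xs)"
    using assms(2) by (intro pairwise_orthogonal_independent) (auto simp: pairwise_def orthogonal_def)
  have "card (set xs) = DIM('a)"
    using \<open>distinct xs\<close> assms(3) by (simp add: distinct_card)
  then show "span (set xs) = UNIV"
    using ind card_ge_dim_independent[of "set xs" UNIV] by auto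
qed

theorem theorem5p2:
  fixes a b c d :: octonion
    and f0 f1 f2 f3 f4 f5 f6 f7 f'0 f'1 f'2 f'3 f'4 f'5 f'6 f'7 :: sedenion
    and F :: "sedenion list"
  assumes "(a, b) \<in> zero_divisors Sed" and "(c, d) \<in> zero_divisors Sed"
    and "(a, b) \<otimes> (c, d) = 0"
    and "cd_norm Oct a = 1" and "cd_norm Oct b = 1"
    and "cd_norm Oct c = 1" and "cd_norm Oct d = 1"
    and "f0 = (cd_unit Oct, 0)"
    and "f1 = (a, b)"
    and "f2 = (c, - d)"
    and "f3 = (a \<odot> c, a \<odot> d)"
    and "f4 = (a \<odot> c, - (a \<odot> d))"
    and "f5 = (c, d)"
    and "f6 = (a, - b)"
    and "f7 = (0, a \<odot> b)"
    and "f'0 = (0, cd_unit Oct)"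
    and "f'1 = (- b, a)"
    and "f'2 = (d, c)"
    and "f'3 = (- (a \<odot> d), a \<odot> c)"
    and "f'4 = (a \<odot> d, a \<odot> c)"
    and "f'5 = (- d, c)"
    and "f'6 = (b, a)"
    and "f'7 = (- (a \<odot> b), 0)"
    and "F = [f0, f1, f2, f3, f4, f5, f6, f7,
             f'0, f'1, f'2, f'3, f'4, f'5, f'6, f'7]"
  shows "independent (set F) \<and> span (set F) = UNIV
    \<and> pairwise (\<lambda>u v. cd_inner Sed u v = 0) (set F)
    \<and> map (\<lambda>u. map (\<lambda>v. u \<otimes> v) F) F =
        [
          [f0, f1, f2, f3, f4, f5, f6, f7, f'0, f'1, f'2, f'3, f'4, f'5, f'6, f'7],
          [f1, (-2) *\<^sub>R f0, 2 *\<^sub>R f3, (-2) *\<^sub>R f2, 0, 0, 2 *\<^sub>R f7, - f6, f'1, (-2) *\<^sub>R f'0, (-2) *\<^sub>R f'3, 2 *\<^sub>R f'2, 0, 0, (-2) *\<^sub>R f'7, f'6],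
          [f2, (-2) *\<^sub>R f3, (-2) *\<^sub>R f0, 2 *\<^sub>R f1, 0, 2 *\<^sub>R f7, 0, - f5, f'2, 2 *\<^sub>R f'3, (-2) *\<^sub>R f'0, (-2) *\<^sub>R f'1, 0, (-2) *\<^sub>R f'7, 0, f'5],
          [f3, 2 *\<^sub>R f2, (-2) *\<^sub>R f1, (-2) *\<^sub>R f0, 2 *\<^sub>R f7, 0, 0, - f4, f'3, (-2) *\<^sub>R f'2, 2 *\<^sub>R f'1, (-2) *\<^sub>R f'0, (-2) *\<^sub>R f'7, 0, 0, f'4],
          [f4, 0, 0, (-2) *\<^sub>R f7, (-2) *\<^sub>R f0, (-2) *\<^sub>R f6, 2 *\<^sub>R f5, f3, f'4, 0, 0, 2 *\<^sub>R f'7, (-2) *\<^sub>R f'0, 2 *\<^sub>R f'6, (-2) *\<^sub>R f'5, - f'3],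
          [f5, 0, (-2) *\<^sub>R f7, 0, 2 *\<^sub>R f6, (-2) *\<^sub>R f0, (-2) *\<^sub>R f4, f2, f'5, 0, 2 *\<^sub>R f'7, 0, (-2) *\<^sub>R f'6, (-2) *\<^sub>R f'0, 2 *\<^sub>R f'4, - f'2],
          [f6, (-2) *\<^sub>R f7, 0, 0, (-2) *\<^sub>R f5, 2 *\<^sub>R f4, (-2) *\<^sub>R f0, f1, f'6, 2 *\<^sub>R f'7, 0, 0, 2 *\<^sub>R f'5, (-2) *\<^sub>R f'4, (-2) *\<^sub>R f'0, - f'1],
          [f7, f6, f5, f4, - f3, - f2, - f1, - f0, f'7, - f'6, - f'5, - f'4, f'3, f'2, f'1, - f'0],
          [f'0, - f'1, - f'2, - f'3, - f'4, - f'5, - f'6, - f'7, - f0, f1, f2, f3, f4, f5, f6, f7],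
          [f'1, 2 *\<^sub>R f'0, (-2) *\<^sub>R f'3, 2 *\<^sub>R f'2, 0, 0, (-2) *\<^sub>R f'7, f'6, - f1, (-2) *\<^sub>R f0, (-2) *\<^sub>R f3, 2 *\<^sub>R f2, 0, 0, (-2) *\<^sub>R f7, f6],
          [f'2, 2 *\<^sub>R f'3, 2 *\<^sub>R f'0, (-2) *\<^sub>R f'1, 0, (-2) *\<^sub>R f'7, 0, f'5, - f2, 2 *\<^sub>R f3, (-2) *\<^sub>R f0, (-2) *\<^sub>R f1, 0, (-2) *\<^sub>R f7, 0, f5],
          [f'3, (-2) *\<^sub>R f'2, 2 *\<^sub>R f'1, 2 *\<^sub>R f'0, (-2) *\<^sub>R f'7, 0, 0, f'4, - f3, (-2) *\<^sub>R f2, 2 *\<^sub>R f1, (-2) *\<^sub>R f0, (-2) *\<^sub>R f7, 0, 0, f4],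
          [f'4, 0, 0, 2 *\<^sub>R f'7, 2 *\<^sub>R f'0, 2 *\<^sub>R f'6, (-2) *\<^sub>R f'5, - f'3, - f4, 0, 0, 2 *\<^sub>R f7, (-2) *\<^sub>R f0, 2 *\<^sub>R f6, (-2) *\<^sub>R f5, - f3],
          [f'5, 0, 2 *\<^sub>R f'7, 0, (-2) *\<^sub>R f'6, 2 *\<^sub>R f'0, 2 *\<^sub>R f'4, - f'2, - f5, 0, 2 *\<^sub>R f7, 0, (-2) *\<^sub>R f6, (-2) *\<^sub>R f0, 2 *\<^sub>R f4, - f2],
          [f'6, 2 *\<^sub>R f'7, 0, 0, 2 *\<^sub>R f'5, (-2) *\<^sub>R f'4, 2 *\<^sub>R f'0, - f'1, - f6, 2 *\<^sub>R f7, 0, 0, 2 *\<^sub>R f5, (-2) *\<^sub>R f4, (-2) *\<^sub>R f0, - f1],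
          [f'7, - f'6, - f'5, - f'4, f'3, f'2, f'1, f'0, - f7, - f6, - f5, - f4, f3, f2, f1, - f0]
        ]"
proof -
  note [simp] = assms(8-23)
  have unit: "a \<bullet> a = 1" "b \<bullet> b = 1" "c \<bullet> c = 1" "d \<bullet> d = 1"
    using assms(4-7) by (simp_all add: oct.norm_eq)
  \<comment> \<open>With names for the three products, the multiplication table relates atoms only and can be used
    as a set of rewrite rules.\<close>
  define p q r where pqr: "p = a \<odot> b" "q = a \<odot> c" "r = a \<odot> d"
  note triples = zero_product_quaternionic_triples[OF assms(3) unit, folded pqr]
  note rel = triples[unfolded quaternionic_triple_def imaginary_unit_def]
  have im: "imaginary_unit a" "imaginary_unit b" "imaginary_unit c" "imaginary_unit d"
    "imaginary_unit p" "imaginary_unit q" "imaginary_unit r"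
    using triples by (simp_all only: quaternionic_triple_def)
  have gram: "sorted_wrt (\<lambda>u v. u \<bullet> v = 0) [cd_unit Oct, a, b, c, d, p, q, r]"
    "\<forall>u \<in> {a, b, c, d, p, q, r}. u \<bullet> u = 1"
    using rel by (simp_all add: inner_commute)
  have orth: "sorted_wrt (\<lambda>u v. u \<bullet> v = 0) F"
    using gram unfolding assms(24)
    by (simp add: inner_commute pqr[symmetric])
  have nz: "0 \<notin> set F"
    using gram unfolding assms(24) by (auto simp: Pair_eq_zero oct.unit_nonzero pqr[symmetric])
  have len: "length F = DIM(sedenion)"
    by (simp add: assms(24))
  show ?thesis
    unfolding Sed_inner
  proof (intro conjI orthogonal_list_basis[OF orth nz len], goal_cases)
    case 1
    show ?case
      using rel im[THEN imaginary_unit_conj] im[THEN imaginary_unit_alternative(3)]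
      unfolding assms(24)
      by (simp add: Sed_mult_Pair oct.conj_unit oct.conj_simps Pair_eq_zero scaleR_2 pqr[symmetric])
  qed
qed

end
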